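(* For every $n\geq 2$, there exists a $C(n)>0$ such that if $(\mathbb{R}^n,g)$ is a rotationally symmetric metric with $\int_{\mathbb{R}^n}|\mathrm{Rm}_g|^{\frac{n}{2}}\, dV_g<C(n)$, then $(\mathbb{R}^n,g)$ does not contain any minimal hyperspheres.
   Context: A rotationally symmetric metric on $\mathbb{R}^n$ is one of the standard form $g=dr^2+f(r)^2\,d\sigma^2$, where $r$ is the metric distance to the origin, $d\sigma^2$ is the standard metric on $S^{n-1}$, $f(r)>0$ for $r>0$, and $f$ extends to a smooth odd function of $r$ with $f'(0)=1$ (so that $g$ is smooth at the origin). A minimal hypersphere is a distance sphere $\{r=R\}$, $R>0$, that is minimal; $(\mathbb{R}^n,g)$ contains a minimal hypersphere exactly when there exists $R>0$ with $f'(R)=0$. $\mathrm{Rm}_g$ is the Riemann curvature tensor and $|\cdot|$ its pointwise norm with respect to $g$. No asymptotic flatness is assumed. *)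

theory Defs
  imports "HOL-Analysis.Analysis"
begin

section \<open>Riemannian geometry on $R^n$ in Cartesian coordinates\<close>

text \<open>A Riemannian metric on $R^n$ is given by its matrix field in the Cartesian coordinates.\<close>

type_synonym 'n metric = "real^'n \<Rightarrow> real^'n^'n"

type_synonym 'n vfield = "real^'n \<Rightarrow> real^'n"

definition partial_deriv :: "'n::finite \<Rightarrow> (real^'n \<Rightarrow> real) \<Rightarrow> real^'n \<Rightarrow> real" where
  "partial_deriv i h x = deriv (\<lambda>t. h (x + t *\<^sub>R axis i 1)) 0"

definition inv_metric :: "'n::finite metric \<Rightarrow> 'n metric" where
  "inv_metric g x = matrix_inv (g x)"

text \<open>\<open>christoffel g k i j\<close> is $\Gamma^k_{ij}$.\<close>

definition christoffel :: "'n::finite metric \<Rightarrow> 'n \<Rightarrow> 'n \<Rightarrow> 'n \<Rightarrow> real^'n \<Rightarrow> real" where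
  "christoffel g k i j x =
     (1/2) * (\<Sum>l\<in>UNIV. inv_metric g x $ k $ l *
        (partial_deriv i (\<lambda>y. g y $ j $ l) x
         + partial_deriv j (\<lambda>y. g y $ i $ l) x
         - partial_deriv l (\<lambda>y. g y $ i $ j) x))"

text \<open>\<open>riemann_up g l i j k\<close> is the component $R^l_{ijk}$ in $R(\partial_i,\partial_j)\partial_k = R^l_{ijk}\,\partial_l$,
  where $R(X,Y) = \nabla_X\nabla_Y - \nabla_Y\nabla_X - \nabla_{[X,Y]}$.\<close>

definition riemann_up ::
    "'n::finite metric \<Rightarrow> 'n \<Rightarrow> 'n \<Rightarrow> 'n \<Rightarrow> 'n \<Rightarrow> real^'n \<Rightarrow> real" where
  "riemann_up g l i j k x =
     partial_deriv i (christoffel g l j k) x - partial_deriv j (christoffel g l i k) x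
     + (\<Sum>m\<in>UNIV. christoffel g l i m x * christoffel g m j k x
                - christoffel g l j m x * christoffel g m i k x)"

text \<open>The (0,4)-tensor $g(R(\partial_i,\partial_j)\partial_k,\partial_l)$.\<close>

definition riemann ::
    "'n::finite metric \<Rightarrow> 'n \<Rightarrow> 'n \<Rightarrow> 'n \<Rightarrow> 'n \<Rightarrow> real^'n \<Rightarrow> real" where
  "riemann g i j k l x = (\<Sum>m\<in>UNIV. g x $ l $ m * riemann_up g m i j k x)"

definition riemann_norm :: "'n::finite metric \<Rightarrow> real^'n \<Rightarrow> real" where
  "riemann_norm g x = sqrt
     (\<Sum>i\<in>UNIV. \<Sum>j\<in>UNIV. \<Sum>k\<in>UNIV. \<Sum>l\<in>UNIV.
      \<Sum>a\<in>UNIV. \<Sum>b\<in>UNIV. \<Sum>c\<in>UNIV. \<Sum>d\<in>UNIV.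
        inv_metric g x $ i $ a * inv_metric g x $ j $ b *
        inv_metric g x $ k $ c * inv_metric g x $ l $ d *
        riemann g i j k l x * riemann g a b c d x)"

definition riem_volume :: "'n::finite metric \<Rightarrow> (real^'n) measure" where
  "riem_volume g = density lborel (\<lambda>x. ennreal (sqrt (det (g x))))"

text \<open>$\int |Rm_g|^{n/2}\,dV_g$, with value \<open>\<infinity>\<close> allowed.\<close>

definition curvature_integral :: "'n::finite metric \<Rightarrow> ennreal" where
  "curvature_integral g =
     (\<integral>\<^sup>+x. ennreal (riemann_norm g x powr (real CARD('n) / 2)) \<partial>riem_volume g)"


section \<open>Mean curvature\<close>

definition metric_inner :: "'n::finite metric \<Rightarrow> real^'n \<Rightarrow> real^'n \<Rightarrow> real^'n \<Rightarrow> real" where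
  "metric_inner g x v w = v \<bullet> (g x *v w)"

definition gradient :: "'n::finite metric \<Rightarrow> (real^'n \<Rightarrow> real) \<Rightarrow> 'n vfield" where
  "gradient g F x = inv_metric g x *v (\<chi> i. partial_deriv i F x)"

text \<open>The unit normal to the level sets of \<open>F\<close>.\<close>

definition unit_normal :: "'n::finite metric \<Rightarrow> (real^'n \<Rightarrow> real) \<Rightarrow> 'n vfield" where
  "unit_normal g F x =
     gradient g F x /\<^sub>R sqrt (metric_inner g x (gradient g F x) (gradient g F x))"

text \<open>$\nabla_v X$ at the point \<open>x\<close>.\<close>

definition cov_deriv :: "'n::finite metric \<Rightarrow> real^'n \<Rightarrow> 'n vfield \<Rightarrow> real^'n \<Rightarrow> real^'n" where
  "cov_deriv g v X x =
     (\<chi> k. \<Sum>i\<in>UNIV. v $ i * (partial_deriv i (\<lambda>y. X y $ k) x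
                          + (\<Sum>j\<in>UNIV. christoffel g k i j x * X x $ j)))"

text \<open>The trace, over the orthogonal complement of the unit vector \<open>N x\<close>, of the bilinear
  form $(v,w) \mapsto g(\nabla_v N, w)$: the full trace minus the value at $(N,N)$.  When
  \<open>N\<close> restricts to a unit normal field of a hypersurface through \<open>x\<close>, this is the trace of
  its second fundamental form.\<close>

definition mean_curvature :: "'n::finite metric \<Rightarrow> 'n vfield \<Rightarrow> real^'n \<Rightarrow> real" where
  "mean_curvature g N x =
     (\<Sum>i\<in>UNIV. cov_deriv g (axis i 1) N x $ i)
     - metric_inner g x (cov_deriv g (N x) N x) (N x)"


section \<open>Rotationally symmetric metrics\<close>

definition smooth_real :: "(real \<Rightarrow> real) \<Rightarrow> bool" where
  "smooth_real f \<longleftrightarrow> (\<forall>k x. (deriv ^^ k) f differentiable (at x))"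

text \<open>\<open>f\<close> is the smooth odd extension to the whole line of the warping function.\<close>

definition warping_function :: "(real \<Rightarrow> real) \<Rightarrow> bool" where
  "warping_function f \<longleftrightarrow>
     smooth_real f \<and> (\<forall>r. f (- r) = - f r) \<and> deriv f 0 = 1 \<and> (\<forall>r>0. f r > 0)"

text \<open>The standard metric $d\sigma^2$ of the unit sphere, pulled back to $R^n\setminus 0$ along
  the radial projection \<open>sgn\<close>, $x \mapsto x/|x|$.\<close>

definition sphere_metric :: "'n::finite metric" where
  "sphere_metric x =
     (\<chi> i j. \<Sum>k\<in>UNIV. partial_deriv i (\<lambda>y. sgn y $ k) x * partial_deriv j (\<lambda>y. sgn y $ k) x)"

text \<open>$dr^2 + f(r)^2 d\sigma^2$ with $r = |x|$, the distance from the origin in this metric.  The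
  polar form degenerates at the origin; \<open>mat 1\<close> is the continuous extension because
  $f'(0) = 1$.\<close>

definition rot_metric :: "(real \<Rightarrow> real) \<Rightarrow> 'n::finite metric" where
  "rot_metric f x =
     (if x = 0 then mat 1
      else (\<chi> i j. partial_deriv i norm x * partial_deriv j norm x
                   + (f (norm x))\<^sup>2 * sphere_metric x $ i $ j))"

definition rotationally_symmetric :: "'n::finite metric \<Rightarrow> bool" where
  "rotationally_symmetric g \<longleftrightarrow> (\<exists>f. warping_function f \<and> g = rot_metric f)"

text \<open>Minimality of the distance sphere $\{r = R\}$; for the metrics \<open>rot_metric f\<close>, the distance
  from the origin is the Euclidean norm.\<close>

definition minimal_hypersphere :: "'n::finite metric \<Rightarrow> real \<Rightarrow> bool" where
  "minimal_hypersphere g R \<longleftrightarrow>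
     R > 0 \<and> (\<forall>x\<in>sphere 0 R. mean_curvature g (unit_normal g norm) x = 0)"

end

theory Submission
  imports Defs
begin

text \<open>
  Write $r = |x|$, $u = x/|x|$, $P = I - u u^T$ and $h = (f(r)/r)^2$.  Away from the origin the metric
  is $u u^T + h P$, and every tensor derived from it is a combination of products of $u$ and $P$ with
  radial coefficients.  Differentiating in Cartesian coordinates and contracting with $|u| = 1$,
  $Pu = 0$, $P^2 = P$ gives the classical picture (\<open>riemann_norm_eq\<close>, \<open>mean_curvature_sphere\<close>,
  \<open>det_rot_metric\<close>): the sectional curvatures are $-f''/f$ for planes containing the radial direction
  and $(1 - f'^2)/f^2$ for tangential planes, so that
  \[ |Rm|^2 = 4(n-1) (f''/f)^2 + 2(n-1)(n-2) ((1 - f'^2)/f^2)^2, \]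
  the sphere of radius $r$ has mean curvature $(n-1) f'/f$, and the volume density is $(f/r)^{n-1}$.

  A minimal sphere of radius $R$ therefore forces $f'(R) = 0$, while $f'(0) = 1$.  Hence there is an
  interval $(a,b)$ on which $f'$ stays between $0$ and $1/2$ and across which it drops by at least $1/2$
  (\<open>descent_interval\<close>).  On this interval
  \[ |Rm|^{n/2} f^{n-1} \ge |f''| \]
  (\<open>curvature_density_bound\<close>).  For $n = 2$ this is just the radial curvature.  For $n \ge 3$ the
  tangential curvature makes the scale invariant quantity $|Rm| f^2$ at least $1$, because
  $1 - f'^2 \ge 3/4$; so $(|Rm| f^2)^{n/2} \ge |Rm| f^2 \ge |f''| f$, and dividing by $f$ gives the
  claim.  In polar coordinates the curvature integral is thus at least
  $n \omega_n \int_a^b |f''| \ge n \omega_n / 2$, where $\omega_n$ is the volume of the Euclidean unit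
  ball (\<open>curvature_integral_ge\<close>).  This constant depends only on $n$.
\<close>

section \<open>Partial derivatives away from the origin\<close>

definition has_partial :: "'n::finite \<Rightarrow> (real^'n \<Rightarrow> real) \<Rightarrow> real \<Rightarrow> real^'n \<Rightarrow> bool" where
  "has_partial i h D x \<longleftrightarrow> ((\<lambda>t. h (x + t *\<^sub>R axis i 1)) has_real_derivative D) (at 0)"

lemma partial_deriv_eqI: "has_partial i h D x \<Longrightarrow> partial_deriv i h x = D"
  unfolding has_partial_def partial_deriv_def by (rule DERIV_imp_deriv)

lemma has_partial_const: "has_partial i (\<lambda>y. c) 0 x"
  unfolding has_partial_def by simp

lemma has_partial_add:
  "has_partial i h D x \<Longrightarrow> has_partial i k E x \<Longrightarrow> has_partial i (\<lambda>y. h y + k y) (D + E) x"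
  unfolding has_partial_def by (rule DERIV_add)

lemma has_partial_diff:
  "has_partial i h D x \<Longrightarrow> has_partial i k E x \<Longrightarrow> has_partial i (\<lambda>y. h y - k y) (D - E) x"
  unfolding has_partial_def by (rule DERIV_diff)

lemma has_partial_mult:
  "has_partial i h D x \<Longrightarrow> has_partial i k E x \<Longrightarrow>
    has_partial i (\<lambda>y. h y * k y) (D * k x + E * h x) x"
  unfolding has_partial_def
  by (drule (1) DERIV_mult) (simp add: ac_simps)

text \<open>Closed forms of the geometric quantities hold only off the origin; this open set suffices for
  differentiating them there.\<close>

lemma has_partial_cong:
  assumes "x \<noteq> 0" "\<And>y. y \<noteq> 0 \<Longrightarrow> h y = k y"
  shows "has_partial i h D x \<longleftrightarrow> has_partial i k D x"
proof -
  have "((\<lambda>t. x + t *\<^sub>R axis i 1) \<longlongrightarrow> x + 0 *\<^sub>R axis i 1) (nhds 0)"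
    by (intro tendsto_intros filterlim_ident)
  then have "\<forall>\<^sub>F t in nhds 0. x + t *\<^sub>R axis i 1 \<noteq> 0"
    using assms(1) by (auto intro!: tendsto_imp_eventually_ne)
  then have "\<forall>\<^sub>F t in nhds 0. h (x + t *\<^sub>R axis i 1) = k (x + t *\<^sub>R axis i 1)"
    by eventually_elim (rule assms(2))
  then show ?thesis
    unfolding has_partial_def by (intro DERIV_cong_ev) auto
qed

lemma partial_deriv_cong:
  assumes "x \<noteq> 0" "\<And>y. y \<noteq> 0 \<Longrightarrow> h y = k y"
  shows "partial_deriv i h x = partial_deriv i k x"
  using has_partial_cong[of x h k, OF assms]
  unfolding partial_deriv_def deriv_def has_partial_def by simp

lemma has_partial_component: "has_partial i (\<lambda>y. y $ j) (if i = j then 1 else 0) x"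
  unfolding has_partial_def by (auto simp: axis_def intro!: derivative_eq_intros)

lemma has_partial_norm:
  assumes "x \<noteq> 0"
  shows "has_partial i norm (sgn x $ i) x"
proof -
  have n: "(norm has_derivative (\<lambda>y. y \<bullet> sgn x)) (at (x + 0 *\<^sub>R axis i 1))"
    using has_derivative_norm[OF assms] by simp
  have "((\<lambda>t::real. x + t *\<^sub>R axis i 1) has_derivative (\<lambda>t. t *\<^sub>R axis i 1)) (at 0)"
    by (auto intro!: derivative_eq_intros)
  from has_derivative_compose[OF this n]
  show ?thesis
    unfolding has_partial_def has_field_derivative_def
    by (simp add: inner_axis' mult.commute[of _ "sgn x $ i"])
qed

lemma has_partial_radial:
  assumes "x \<noteq> 0" "(F has_real_derivative D) (at (norm x))"
  shows "has_partial i (\<lambda>y. F (norm y)) (D * sgn x $ i) x"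
  using has_partial_norm[OF assms(1), of i] assms(2) unfolding has_partial_def
  by (intro DERIV_chain2[where f = F and g = "\<lambda>t. norm (x + t *\<^sub>R axis i 1)"]) auto

text \<open>The matrix of the Euclidean orthogonal projection onto the complement of the position vector.\<close>

definition tproj :: "real^'n::finite \<Rightarrow> 'n \<Rightarrow> 'n \<Rightarrow> real" where
  "tproj x i j = (if i = j then 1 else 0) - sgn x $ i * sgn x $ j"

lemma tproj_sym: "tproj x i j = tproj x j i"
  by (simp add: tproj_def)

lemma has_partial_sgn:
  assumes "x \<noteq> 0"
  shows "has_partial i (\<lambda>y. sgn y $ j) (tproj x i j / norm x) x"
proof -
  have "has_partial i (\<lambda>y. inverse (norm y)) (- (inverse (norm x * norm x)) * sgn x $ i) x"
    using assms by (intro has_partial_radial) (auto intro!: derivative_eq_intros)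
  from has_partial_mult[OF has_partial_component[of i j] this]
  show ?thesis using assms
    unfolding tproj_def sgn_vec_def
    by (auto elim!: back_subst[where P = "\<lambda>D. has_partial i _ D x"] simp: field_simps)
qed

lemma has_partial_tproj:
  assumes "x \<noteq> 0"
  shows "has_partial i (\<lambda>y. tproj y j k)
    (- (tproj x i j * sgn x $ k + tproj x i k * sgn x $ j) / norm x) x"
  using has_partial_diff[OF has_partial_const[of _ "if j = k then 1 else 0"]
      has_partial_mult[OF has_partial_sgn[OF assms, of i j] has_partial_sgn[OF assms, of i k]]]
  unfolding tproj_def[of _ j k] by (simp add: diff_divide_distrib split del: if_split)

lemma sum_sgn_sgn: "x \<noteq> 0 \<Longrightarrow> (\<Sum>i\<in>UNIV. sgn x $ i * sgn (x::real^'n::finite) $ i) = 1"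
  using norm_sgn[of x] by (simp add: norm_eq_1 inner_vec_def)

lemma sum_delta_mult:
  "(\<Sum>i\<in>(UNIV::'n::finite set). (if i = j then 1 else 0) * c i) = (c j::real)"
  "(\<Sum>i\<in>(UNIV::'n::finite set). (if j = i then 1 else 0) * c i) = (c j::real)"
  by (auto simp: if_distrib[of "\<lambda>a. a * _"] cong: if_cong)

lemma sum_tproj_sgn:
  assumes "x \<noteq> 0"
  shows "(\<Sum>i\<in>UNIV. tproj x i j * sgn x $ i) = 0"
proof -
  have "(\<Sum>i\<in>UNIV. tproj x i j * sgn x $ i)
      = sgn x $ j - sgn x $ j * (\<Sum>i\<in>UNIV. sgn x $ i * sgn x $ i)"
    unfolding tproj_def left_diff_distrib sum_subtractf sum_delta_mult
    by (simp add: sum_distrib_left ac_simps)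
  then show ?thesis using sum_sgn_sgn[OF assms] by simp
qed

lemma sum_tproj_tproj:
  assumes "x \<noteq> 0"
  shows "(\<Sum>i\<in>UNIV. tproj x i j * tproj x i k) = tproj x j k"
proof -
  have "(\<Sum>i\<in>UNIV. tproj x i j * tproj x i k)
     = (\<Sum>i\<in>UNIV. (if i = k then 1 else 0) * tproj x i j - sgn x $ k * (tproj x i j * sgn x $ i))"
    by (intro sum.cong refl) (simp add: tproj_def[of x _ k] algebra_simps)
  also have "\<dots> = tproj x k j"
    by (simp only: sum_subtractf sum_delta_mult sum_tproj_sgn[OF assms] mult_zero_right diff_zero
        flip: sum_distrib_left)
  finally show ?thesis by (simp add: tproj_sym)
qed

lemma sum_tproj_diag:
  assumes "x \<noteq> 0"
  shows "(\<Sum>i\<in>UNIV. tproj (x::real^'n::finite) i i) = real CARD('n) - 1"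
  unfolding tproj_def by (simp add: sum_subtractf sum_sgn_sgn[OF assms])

text \<open>As a function of any one of its indices, each tensor below is a combination of the radial
  vector and of two columns of the projection.  Every contraction of indices is therefore an instance
  of this pairing; terms that are absent get the coefficient \<open>0\<close>.\<close>

lemma contract:
  fixes x :: "real^'n::finite"
  assumes "x \<noteq> 0"
  shows "(\<Sum>l\<in>UNIV. (a * sgn x $ l + b * tproj x l i + c * tproj x l j)
            * (a' * sgn x $ l + b' * tproj x l p + c' * tproj x l q))
       = a * a' + b * b' * tproj x i p + b * c' * tproj x i q
           + c * b' * tproj x j p + c * c' * tproj x j q"
proof -
  have "(\<Sum>l\<in>UNIV. (a * sgn x $ l + b * tproj x l i + c * tproj x l j)
            * (a' * sgn x $ l + b' * tproj x l p + c' * tproj x l q))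
     = a * a' * (\<Sum>l\<in>UNIV. sgn x $ l * sgn x $ l)
       + a * b' * (\<Sum>l\<in>UNIV. tproj x l p * sgn x $ l)
       + a * c' * (\<Sum>l\<in>UNIV. tproj x l q * sgn x $ l)
       + b * a' * (\<Sum>l\<in>UNIV. tproj x l i * sgn x $ l)
       + c * a' * (\<Sum>l\<in>UNIV. tproj x l j * sgn x $ l)
       + b * b' * (\<Sum>l\<in>UNIV. tproj x l i * tproj x l p)
       + b * c' * (\<Sum>l\<in>UNIV. tproj x l i * tproj x l q)
       + c * b' * (\<Sum>l\<in>UNIV. tproj x l j * tproj x l p)
       + c * c' * (\<Sum>l\<in>UNIV. tproj x l j * tproj x l q)"
    unfolding sum_distrib_left sum.distrib[symmetric]
    by (intro sum.cong refl) algebra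
  then show ?thesis
    by (simp add: sum_sgn_sgn sum_tproj_sgn sum_tproj_tproj assms)
qed

section \<open>The metric, its inverse, and its Christoffel symbols\<close>

lemma sphere_metric_eq:
  assumes "x \<noteq> 0"
  shows "sphere_metric x $ i $ j = tproj x i j / (norm x)\<^sup>2"
proof -
  have "sphere_metric x $ i $ j
      = (\<Sum>k\<in>UNIV. (tproj x i k / norm x) * (tproj x j k / norm x))"
    unfolding sphere_metric_def
    by (simp add: partial_deriv_eqI[OF has_partial_sgn[OF assms]])
  also have "\<dots> = (\<Sum>k\<in>UNIV. tproj x k i * tproj x k j) / (norm x)\<^sup>2"
    by (simp add: sum_divide_distrib power2_eq_square tproj_sym[of x i] tproj_sym[of x j])
  finally show ?thesis by (simp add: sum_tproj_tproj[OF assms])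
qed

lemma rot_metric_eq:
  assumes "x \<noteq> 0"
  shows "rot_metric f x $ i $ j
    = sgn x $ i * sgn x $ j + (f (norm x) / norm x)\<^sup>2 * tproj x i j"
  using assms unfolding rot_metric_def
  by (simp add: partial_deriv_eqI[OF has_partial_norm] sphere_metric_eq power_divide)

lemma matrix_inv_unique:
  fixes A B :: "real^'n::finite^'n"
  assumes "A ** B = mat 1"
  shows "matrix_inv A = B"
proof -
  have BA: "B ** A = mat 1" using assms matrix_left_right_inverse by blast
  have "\<exists>A'. A ** A' = mat 1 \<and> A' ** A = mat 1" using assms BA by blast
  then have "A ** matrix_inv A = mat 1"
    unfolding matrix_inv_def by (rule someI2_ex) simp
  then have "B ** (A ** matrix_inv A) = B" by simp
  then show ?thesis by (simp add: matrix_mul_assoc BA)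
qed

lemma inv_metric_eq:
  fixes x :: "real^'n::finite"
  assumes "x \<noteq> 0" "f (norm x) > 0"
  shows "inv_metric (rot_metric f) x $ i $ j
    = sgn x $ i * sgn x $ j + tproj x i j / (f (norm x) / norm x)\<^sup>2"
proof -
  define h where "h = (f (norm x) / norm x)\<^sup>2"
  have h: "h \<noteq> 0" using assms by (simp add: h_def)
  define B :: "real^'n^'n" where "B = (\<chi> i j. sgn x $ i * sgn x $ j + tproj x i j / h)"
  have "(rot_metric f x ** B) $ p $ q = mat 1 $ p $ q" for p q
  proof -
    have "(rot_metric f x ** B) $ p $ q
        = (\<Sum>l\<in>UNIV. (sgn x $ p * sgn x $ l + h * tproj x l p + 0 * tproj x l p)
             * (sgn x $ q * sgn x $ l + 1 / h * tproj x l q + 0 * tproj x l q))"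
      unfolding matrix_matrix_mult_def B_def
      by (simp add: rot_metric_eq[OF assms(1)] flip: h_def)
        (simp add: ac_simps tproj_sym[of x p])
    also have "\<dots> = sgn x $ p * sgn x $ q + tproj x p q"
      unfolding contract[OF assms(1)] using h by simp
    finally show ?thesis by (simp add: tproj_def mat_def)
  qed
  then have "rot_metric f x ** B = mat 1" by (simp add: vec_eq_iff)
  from matrix_inv_unique[OF this] show ?thesis
    by (simp add: inv_metric_def B_def h_def)
qed

text \<open>The curvature of the metric involves the warping function up to its second derivative.  Fixing the
  derivatives as functions makes the differentiation facts below usable as derivative rules.\<close>

locale warping =
  fixes f f' f'' :: "real \<Rightarrow> real"
  assumes f_deriv: "(f has_real_derivative f' r) (at r)"
    and f'_deriv: "(f' has_real_derivative f'' r) (at r)"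
    and f_pos: "r > 0 \<Longrightarrow> f r > 0"
begin

text \<open>The Christoffel symbols measure the difference between the Levi-Civita connection and the flat
  one.  A tangential field is differentiated radially at the rate $f'/f$ instead of $1/r$, and two
  tangential vectors produce the radial component $-f f'/r^2$ instead of $-1/r$ times their Euclidean
  inner product.\<close>

definition alpha :: "real \<Rightarrow> real" where
  "alpha r = f' r / f r - 1 / r"

definition beta :: "real \<Rightarrow> real" where
  "beta r = 1 / r - f r * f' r / r\<^sup>2"

lemma f_norm_pos: "x \<noteq> 0 \<Longrightarrow> f (norm x) > 0"
  by (rule f_pos) simp

lemma has_partial_rot_metric:
  assumes "x \<noteq> 0"
  defines "r \<equiv> norm x"
  defines "h \<equiv> (f r / r)\<^sup>2"
  shows "has_partial k (\<lambda>y. rot_metric f y $ i $ j)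
    ((1 - h) / r * (tproj x k i * sgn x $ j + tproj x k j * sgn x $ i)
      + 2 * (f r * f' r / r\<^sup>2 - h / r) * sgn x $ k * tproj x i j) x"
proof -
  have r: "r \<noteq> 0" using assms by simp
  have "((\<lambda>r. (f r / r)\<^sup>2) has_real_derivative 2 * (f r * f' r / r\<^sup>2 - h / r)) (at (norm x))"
    using r unfolding h_def r_def
    by (auto intro!: derivative_eq_intros f_deriv simp: field_simps power2_eq_square)
  note has_partial_radial[OF assms(1) this]
  from has_partial_add[OF has_partial_mult[OF has_partial_sgn[OF assms(1), of k i]
        has_partial_sgn[OF assms(1), of k j]]
      has_partial_mult[OF this has_partial_tproj[OF assms(1), of k i j]]]
  have "has_partial k (\<lambda>y. sgn y $ i * sgn y $ j + (f (norm y) / norm y)\<^sup>2 * tproj y i j)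
    ((1 - h) / r * (tproj x k i * sgn x $ j + tproj x k j * sgn x $ i)
      + 2 * (f r * f' r / r\<^sup>2 - h / r) * sgn x $ k * tproj x i j) x"
    unfolding r_def[symmetric] h_def[symmetric]
    by (rule back_subst[where P = "\<lambda>D. has_partial k _ D x"]) (simp add: r field_simps)
  then show ?thesis
    by (subst has_partial_cong[OF assms(1) rot_metric_eq])
qed

lemma christoffel_eq:
  assumes "x \<noteq> 0"
  shows "christoffel (rot_metric f) k i j x
    = alpha (norm x) * (sgn x $ i * tproj x k j + sgn x $ j * tproj x k i)
      + beta (norm x) * tproj x i j * sgn x $ k"
proof -
  define r where "r = norm x"
  define h where "h = (f r / r)\<^sup>2"
  define d where "d = f r * f' r / r\<^sup>2 - h / r"
  have r: "r \<noteq> 0" and fr: "f r \<noteq> 0"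
    using assms f_norm_pos[of x] by (auto simp: r_def)
  have "christoffel (rot_metric f) k i j x
    = (\<Sum>l\<in>UNIV. (sgn x $ k * sgn x $ l + 1 / h * tproj x l k + 0 * tproj x l k)
       * (((1 - h) / r - d) * tproj x i j * sgn x $ l
           + d * sgn x $ j * tproj x l i + d * sgn x $ i * tproj x l j))"
    unfolding christoffel_def sum_distrib_left
      partial_deriv_eqI[OF has_partial_rot_metric[OF assms]]
      inv_metric_eq[of x f, OF assms f_norm_pos[OF assms]]
      r_def[symmetric] h_def[symmetric] d_def[symmetric]
    by (intro sum.cong refl)
      (simp add: tproj_sym algebra_simps)
  also have "\<dots> = sgn x $ k * (((1 - h) / r - d) * tproj x i j)
      + d / h * (sgn x $ j * tproj x k i + sgn x $ i * tproj x k j)"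
    unfolding contract[OF assms] by (simp add: tproj_sym algebra_simps)
  also have "(1 - h) / r - d = beta r"
    using r by (simp add: beta_def d_def h_def field_simps power2_eq_square)
  also have "d / h = alpha r"
    using r fr by (simp add: alpha_def d_def h_def field_simps power2_eq_square)
  finally show ?thesis by (simp add: r_def algebra_simps)
qed

section \<open>The curvature tensor\<close>

text \<open>The sectional curvatures of the planes that contain, respectively are orthogonal to, the radial
  direction.\<close>

definition K_rad :: "real \<Rightarrow> real" where
  "K_rad r = - f'' r / f r"

definition K_tan :: "real \<Rightarrow> real" where
  "K_tan r = (1 - (f' r)\<^sup>2) / (f r)\<^sup>2"

lemma has_partial_christoffel:
  assumes "x \<noteq> 0"
  defines "r \<equiv> norm x"
  shows "has_partial i (christoffel (rot_metric f) l j k)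
    ((f'' r / f r - (f' r / f r)\<^sup>2 + 1 / r\<^sup>2) * sgn x $ i
         * (sgn x $ j * tproj x l k + sgn x $ k * tproj x l j)
      + alpha r / r * (tproj x i j * tproj x l k + tproj x i k * tproj x l j
         - sgn x $ j * (tproj x i l * sgn x $ k + tproj x i k * sgn x $ l)
         - sgn x $ k * (tproj x i l * sgn x $ j + tproj x i j * sgn x $ l))
      + (- 1 / r\<^sup>2 - ((f' r)\<^sup>2 + f r * f'' r) / r\<^sup>2 + 2 * f r * f' r / r ^ 3)
         * sgn x $ i * tproj x j k * sgn x $ l
      + beta r / r * (tproj x j k * tproj x i l
         - sgn x $ l * (tproj x i j * sgn x $ k + tproj x i k * sgn x $ j))) x"
    (is "has_partial i _ ?E x")
proof -
  note x = assms(1)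
  have r: "r \<noteq> 0" and fr: "f r \<noteq> 0"
    using assms f_norm_pos[of x] by (auto simp: r_def)
  have a: "(alpha has_real_derivative f'' r / f r - (f' r / f r)\<^sup>2 + 1 / r\<^sup>2) (at (norm x))"
    using r fr unfolding alpha_def[abs_def] r_def
    by (auto intro!: derivative_eq_intros f_deriv f'_deriv simp: field_simps power2_eq_square)
  have b: "(beta has_real_derivative
      - 1 / r\<^sup>2 - ((f' r)\<^sup>2 + f r * f'' r) / r\<^sup>2 + 2 * f r * f' r / r ^ 3) (at (norm x))"
    using r unfolding beta_def[abs_def] r_def
    by (auto intro!: derivative_eq_intros f_deriv f'_deriv
        simp: field_simps power2_eq_square power3_eq_cube)
  (* The product rule produces some derivative E, which is then normalized to the stated form. *)
  have "\<exists>E. has_partial i (\<lambda>y. alpha (norm y) * (sgn y $ j * tproj y l k + sgn y $ k * tproj y l j)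
      + beta (norm y) * tproj y j k * sgn y $ l) E x \<and> E = ?E"
    apply (rule exI, rule conjI)
     apply (rule has_partial_add has_partial_mult has_partial_radial[OF x a] has_partial_radial[OF x b]
        has_partial_sgn[OF x] has_partial_tproj[OF x])+
    apply (unfold r_def[symmetric])
    apply (simp add: add_divide_distrib diff_divide_distrib algebra_simps)
    done
  then show ?thesis
    by (subst has_partial_cong[OF x christoffel_eq]) blast+
qed

text \<open>This is $K_{rad}$ times the mixed terms plus $K_{tan}$ times the purely tangential terms of the
  constant curvature tensor $g_{jk} \delta^l_i - g_{ik} \delta^l_j$.  The quadratic Christoffel terms
  turn the derivatives of the two coefficients into the sectional curvatures.\<close>

lemma riemann_up_eq:
  assumes "x \<noteq> 0"
  defines "r \<equiv> norm x"
  defines "h \<equiv> (f r / r)\<^sup>2"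
  shows "riemann_up (rot_metric f) l i j k x
    = K_rad r * (sgn x $ j * sgn x $ k * tproj x l i + h * tproj x j k * sgn x $ l * sgn x $ i
         - sgn x $ i * sgn x $ k * tproj x l j - h * tproj x i k * sgn x $ l * sgn x $ j)
      + K_tan r * h * (tproj x j k * tproj x l i - tproj x i k * tproj x l j)"
proof -
  note x = assms(1)
  have r: "r \<noteq> 0" and fr: "f r \<noteq> 0"
    using assms f_norm_pos[of x] by (auto simp: r_def)
  have quad: "(\<Sum>m\<in>UNIV. christoffel (rot_metric f) l i m x * christoffel (rot_metric f) m j k x)
     = (alpha r)\<^sup>2 * sgn x $ i * (sgn x $ j * tproj x l k + sgn x $ k * tproj x l j)
       + alpha r * beta r * (tproj x l i * tproj x j k
          + sgn x $ l * (sgn x $ j * tproj x i k + sgn x $ k * tproj x i j))" for i j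
  proof -
    have "(\<Sum>m\<in>UNIV. christoffel (rot_metric f) l i m x * christoffel (rot_metric f) m j k x)
      = (\<Sum>m\<in>UNIV. (alpha r * tproj x l i * sgn x $ m
            + alpha r * sgn x $ i * tproj x m l + beta r * sgn x $ l * tproj x m i)
          * (beta r * tproj x j k * sgn x $ m
            + alpha r * sgn x $ j * tproj x m k + alpha r * sgn x $ k * tproj x m j))"
      unfolding christoffel_eq[OF x] r_def[symmetric]
      by (intro sum.cong refl)
        (simp add: tproj_sym algebra_simps)
    then show ?thesis
      unfolding contract[OF x] by (simp add: tproj_sym algebra_simps power2_eq_square)
  qed
  (* The three combinations of coefficients in which the sectional curvatures appear: those of the
     P P terms, of the u u P terms with two lower u's, and of those with an upper u. *)
  have tt: "beta r / r - alpha r / r + alpha r * beta r = K_tan r * h"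
    using r fr by (simp add: alpha_def beta_def K_tan_def h_def field_simps power2_eq_square)
  define a' where "a' = f'' r / f r - (f' r / f r)\<^sup>2 + 1 / r\<^sup>2"
  define b' where "b' = - 1 / r\<^sup>2 - ((f' r)\<^sup>2 + f r * f'' r) / r\<^sup>2 + 2 * f r * f' r / r ^ 3"
  have a': "a' = - K_rad r - 2 * (alpha r / r) - (alpha r)\<^sup>2"
    using r fr by (simp add: alpha_def a'_def K_rad_def field_simps power2_eq_square)
  have b': "b' = K_rad r * h - alpha r / r - beta r / r + alpha r * beta r"
    using r fr by (simp add: alpha_def beta_def b'_def K_rad_def h_def field_simps
        power2_eq_square power3_eq_cube)
  show ?thesis
    unfolding riemann_up_def sum_subtractf quad
      partial_deriv_eqI[OF has_partial_christoffel[OF x]] r_def[symmetric]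
      a'_def[symmetric] b'_def[symmetric] a' b' tt[symmetric]
      tproj_sym[of x i l] tproj_sym[of x j l] tproj_sym[of x j i]
    by algebra
qed

text \<open>The curvature tensor has all coefficients of the first four terms equal, and likewise of the last
  two.  Separate coefficients are needed because raising a single index rescales only those terms in
  which this index sits on a projection.\<close>

definition curvature_form ::
    "real \<Rightarrow> real \<Rightarrow> real \<Rightarrow> real \<Rightarrow> real \<Rightarrow> real \<Rightarrow> 'n::finite \<Rightarrow> 'n \<Rightarrow> 'n \<Rightarrow> 'n \<Rightarrow> real^'n \<Rightarrow> real" where
  "curvature_form c1 c2 c3 c4 c5 c6 i j k l x =
      c1 * sgn x $ j * sgn x $ k * tproj x l i + c2 * tproj x j k * sgn x $ l * sgn x $ i
    - c3 * sgn x $ i * sgn x $ k * tproj x l j - c4 * tproj x i k * sgn x $ l * sgn x $ j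
    + c5 * tproj x j k * tproj x l i - c6 * tproj x i k * tproj x l j"

lemma riemann_eq:
  assumes "x \<noteq> 0"
  defines "r \<equiv> norm x"
  defines "h \<equiv> (f r / r)\<^sup>2"
  defines "p \<equiv> K_rad r * h" and "q \<equiv> K_tan r * h\<^sup>2"
  shows "riemann (rot_metric f) i j k l x = curvature_form p p p p q q i j k l x"
proof -
  note x = assms(1)
  have "riemann (rot_metric f) i j k l x
    = (\<Sum>m\<in>UNIV. (sgn x $ l * sgn x $ m + h * tproj x m l + 0 * tproj x m l)
        * (p * (tproj x j k * sgn x $ i - tproj x i k * sgn x $ j) * sgn x $ m
           + (K_rad r * sgn x $ j * sgn x $ k + K_tan r * h * tproj x j k) * tproj x m i
           + (- K_rad r * sgn x $ i * sgn x $ k - K_tan r * h * tproj x i k) * tproj x m j))"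
    unfolding riemann_def riemann_up_eq[OF x] rot_metric_eq[OF x] r_def[symmetric] h_def[symmetric]
    by (intro sum.cong refl) (simp add: p_def tproj_sym algebra_simps)
  then show ?thesis
    unfolding contract[OF x]
    by (simp add: curvature_form_def p_def q_def algebra_simps power2_eq_square)
qed

text \<open>The inverse metric fixes $u$ and multiplies $P$ by $1/h$.\<close>

lemma raise_index:
  fixes x :: "real^'n::finite"
  assumes "x \<noteq> 0"
  defines "h \<equiv> (f (norm x) / norm x)\<^sup>2"
  shows "(\<Sum>d\<in>UNIV. inv_metric (rot_metric f) x $ l $ d * curvature_form c1 c2 c3 c4 c5 c6 i j k d x)
      = curvature_form (c1 / h) c2 (c3 / h) c4 (c5 / h) (c6 / h) i j k l x"
    and "(\<Sum>d\<in>UNIV. inv_metric (rot_metric f) x $ k $ d * curvature_form c1 c2 c3 c4 c5 c6 i j d l x)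
      = curvature_form c1 (c2 / h) c3 (c4 / h) (c5 / h) (c6 / h) i j k l x"
    and "(\<Sum>d\<in>UNIV. inv_metric (rot_metric f) x $ j $ d * curvature_form c1 c2 c3 c4 c5 c6 i d k l x)
      = curvature_form c1 (c2 / h) (c3 / h) c4 (c5 / h) (c6 / h) i j k l x"
    and "(\<Sum>d\<in>UNIV. inv_metric (rot_metric f) x $ i $ d * curvature_form c1 c2 c3 c4 c5 c6 d j k l x)
      = curvature_form (c1 / h) c2 c3 (c4 / h) (c5 / h) (c6 / h) i j k l x"
proof -
  have h: "h \<noteq> 0" using assms(1) f_norm_pos[OF assms(1)] by (simp add: h_def)
  have raise: "(\<Sum>d\<in>UNIV. inv_metric (rot_metric f) x $ l $ d * F d)
      = a * sgn x $ l + b / h * tproj x l i + c / h * tproj x l j"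
    if "\<And>d. F d = a * sgn x $ d + b * tproj x d i + c * tproj x d j" for F l a b c i j
  proof -
    have "(\<Sum>d\<in>UNIV. inv_metric (rot_metric f) x $ l $ d * F d)
      = (\<Sum>d\<in>UNIV. (sgn x $ l * sgn x $ d + 1 / h * tproj x d l + 0 * tproj x d l)
          * (a * sgn x $ d + b * tproj x d i + c * tproj x d j))"
      unfolding that inv_metric_eq[of x f, OF assms(1) f_norm_pos[OF assms(1)]] h_def[symmetric]
      by (simp add: tproj_sym)
    then show ?thesis
      unfolding contract[OF assms(1)] using h by (simp add: field_simps)
  qed
  show "(\<Sum>d\<in>UNIV. inv_metric (rot_metric f) x $ l $ d * curvature_form c1 c2 c3 c4 c5 c6 i j k d x)
      = curvature_form (c1 / h) c2 (c3 / h) c4 (c5 / h) (c6 / h) i j k l x"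
    by (subst raise[where i = i and j = j
          and a = "c2 * tproj x j k * sgn x $ i - c4 * tproj x i k * sgn x $ j"
          and b = "c1 * sgn x $ j * sgn x $ k + c5 * tproj x j k"
          and c = "- c3 * sgn x $ i * sgn x $ k - c6 * tproj x i k"])
      (use h in \<open>simp_all add: curvature_form_def tproj_sym field_simps\<close>)
  show "(\<Sum>d\<in>UNIV. inv_metric (rot_metric f) x $ k $ d * curvature_form c1 c2 c3 c4 c5 c6 i j d l x)
      = curvature_form c1 (c2 / h) c3 (c4 / h) (c5 / h) (c6 / h) i j k l x"
    by (subst raise[where i = j and j = i
          and a = "c1 * sgn x $ j * tproj x l i - c3 * sgn x $ i * tproj x l j"
          and b = "c2 * sgn x $ l * sgn x $ i + c5 * tproj x l i"
          and c = "- c4 * sgn x $ l * sgn x $ j - c6 * tproj x l j"])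
      (use h in \<open>simp_all add: curvature_form_def tproj_sym field_simps\<close>)
  show "(\<Sum>d\<in>UNIV. inv_metric (rot_metric f) x $ j $ d * curvature_form c1 c2 c3 c4 c5 c6 i d k l x)
      = curvature_form c1 (c2 / h) (c3 / h) c4 (c5 / h) (c6 / h) i j k l x"
    by (subst raise[where i = k and j = l
          and a = "c1 * sgn x $ k * tproj x l i - c4 * tproj x i k * sgn x $ l"
          and b = "c2 * sgn x $ l * sgn x $ i + c5 * tproj x l i"
          and c = "- c3 * sgn x $ i * sgn x $ k - c6 * tproj x i k"])
      (use h in \<open>simp_all add: curvature_form_def tproj_sym field_simps\<close>)
  show "(\<Sum>d\<in>UNIV. inv_metric (rot_metric f) x $ i $ d * curvature_form c1 c2 c3 c4 c5 c6 d j k l x)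
      = curvature_form (c1 / h) c2 c3 (c4 / h) (c5 / h) (c6 / h) i j k l x"
    by (subst raise[where i = l and j = k
          and a = "c2 * tproj x j k * sgn x $ l - c3 * sgn x $ k * tproj x l j"
          and b = "c1 * sgn x $ j * sgn x $ k + c5 * tproj x j k"
          and c = "- c4 * sgn x $ l * sgn x $ j - c6 * tproj x l j"])
      (use h in \<open>simp_all add: curvature_form_def tproj_sym field_simps\<close>)
qed

text \<open>The radial and the tangential part are orthogonal: a term of one of them carries $u$ where the
  other carries $P$.  The two squared lengths follow from $|u| = 1$ and $\mathrm{tr}\, P = n - 1$ by
  contracting one index after the other.\<close>

lemma sum_curvature_form_product:
  fixes x :: "real^'n::finite"
  assumes "x \<noteq> 0"
  defines "m \<equiv> real CARD('n)"
  shows "(\<Sum>i\<in>UNIV. \<Sum>j\<in>UNIV. \<Sum>k\<in>UNIV. \<Sum>l\<in>UNIV.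
      curvature_form p p p p q q i j k l x * curvature_form p' p' p' p' q' q' i j k l x)
    = 4 * (m - 1) * (p * p') + 2 * (m - 1) * (m - 2) * (q * q')"
proof -
  note x = assms(1)
  let ?u = "\<lambda>i. sgn x $ i" and ?P = "\<lambda>i j. tproj x i j"
  have l: "(\<Sum>l\<in>UNIV. curvature_form p p p p q q i j k l x
          * curvature_form p' p' p' p' q' q' i j k l x)
     = p * p' * (?P j k * ?u i - ?P i k * ?u j)\<^sup>2
       + ?P i i * ((p * ?u j * ?u k + q * ?P j k) * (p' * ?u j * ?u k + q' * ?P j k))
       - ?P i j * ((p * ?u j * ?u k + q * ?P j k) * (p' * ?u i * ?u k + q' * ?P i k))
       - ?P i j * ((p * ?u i * ?u k + q * ?P i k) * (p' * ?u j * ?u k + q' * ?P j k))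
       + ?P j j * ((p * ?u i * ?u k + q * ?P i k) * (p' * ?u i * ?u k + q' * ?P i k))" for i j k
  proof -
    have c: "curvature_form p p p p q q i j k l x
       = p * (?P j k * ?u i - ?P i k * ?u j) * ?u l
         + (p * ?u j * ?u k + q * ?P j k) * ?P l i + - (p * ?u i * ?u k + q * ?P i k) * ?P l j"
      for p q l by (simp add: curvature_form_def algebra_simps)
    show ?thesis
      unfolding c contract[OF x]
      by (simp add: tproj_sym[of x j i] power2_eq_square algebra_simps)
  qed
  have contr: "(\<Sum>k\<in>UNIV. (a * ?u k + b * ?P i k) * (a' * ?u k + b' * ?P j k))
      = a * a' + b * b' * ?P i j" for a b a' b' i j
    using contract[OF x, of a b i 0 i a' b' j 0 j] by (simp add: tproj_sym)
  have sq: "(\<Sum>k\<in>UNIV. (?P j k * ?u i - ?P i k * ?u j)\<^sup>2)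
      = ?P j j * (?u i)\<^sup>2 + ?P i i * (?u j)\<^sup>2 - 2 * ?P i j * ?u i * ?u j" for i j
    using contract[OF x, of 0 "?u i" j "- ?u j" i 0 "?u i" j "- ?u j" i]
    by (simp add: tproj_sym power2_eq_square algebra_simps)
  have k: "(\<Sum>k\<in>UNIV. \<Sum>l\<in>UNIV. curvature_form p p p p q q i j k l x
          * curvature_form p' p' p' p' q' q' i j k l x)
     = p * p' * (2 * (?P j j * (?u i)\<^sup>2) + 2 * (?P i i * (?u j)\<^sup>2) - 4 * ?u i * (?P j i * ?u j))
       + q * q' * (2 * ?P i i * ?P j j - 2 * (?P j i * ?P j i))" for i j
    unfolding l sum.distrib sum_subtractf sum_distrib_left[symmetric] contr sq
    by (simp add: tproj_sym[of x j i] power2_eq_square algebra_simps)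
  have j: "(\<Sum>j\<in>UNIV. \<Sum>k\<in>UNIV. \<Sum>l\<in>UNIV. curvature_form p p p p q q i j k l x
          * curvature_form p' p' p' p' q' q' i j k l x)
     = p * p' * (2 * ((m - 1) * (?u i)\<^sup>2) + 2 * ?P i i)
       + q * q' * (2 * ?P i i * (m - 1) - 2 * ?P i i)" for i
    unfolding k sum.distrib sum_subtractf sum_distrib_left[symmetric] sum_distrib_right[symmetric]
      sum_tproj_sgn[OF x] sum_tproj_tproj[OF x] sum_tproj_diag[OF x] m_def[symmetric]
    by (simp add: power2_eq_square sum_sgn_sgn[OF x])
  show ?thesis
    unfolding j sum.distrib sum_subtractf sum_distrib_left[symmetric] sum_distrib_right[symmetric]
      sum_tproj_diag[OF x] m_def[symmetric]
    by (simp add: power2_eq_square sum_sgn_sgn[OF x] algebra_simps)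
qed

text \<open>Raising all four indices divides the radial part by $h^2$ and the tangential part by $h^4$, since
  two, respectively four, of the indices of their terms sit on a projection.  In the product with the
  lowered tensor, whose two parts have the coefficients $K_{rad} h$ and $K_{tan} h^2$, all powers of
  $h$ cancel.\<close>

lemma riemann_norm_eq:
  fixes x :: "real^'n::finite"
  assumes "x \<noteq> 0"
  defines "m \<equiv> real CARD('n)"
  shows "riemann_norm (rot_metric f) x
    = sqrt (4 * (m - 1) * (K_rad (norm x))\<^sup>2 + 2 * (m - 1) * (m - 2) * (K_tan (norm x))\<^sup>2)"
proof -
  note x = assms(1)
  define h where "h = (f (norm x) / norm x)\<^sup>2"
  define p where "p = K_rad (norm x) * h"
  define q where "q = K_tan (norm x) * h\<^sup>2"
  have h: "h \<noteq> 0" using x f_norm_pos[OF x] by (simp add: h_def)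
  let ?G = "inv_metric (rot_metric f) x"
  have contraction: "(\<Sum>a\<in>UNIV. \<Sum>b\<in>UNIV. \<Sum>c\<in>UNIV. \<Sum>d\<in>UNIV.
        ?G $ i $ a * ?G $ j $ b * ?G $ k $ c * ?G $ l $ d
          * riemann (rot_metric f) i j k l x * riemann (rot_metric f) a b c d x)
      = curvature_form p p p p q q i j k l x
        * curvature_form (p / h\<^sup>2) (p / h\<^sup>2) (p / h\<^sup>2) (p / h\<^sup>2) (q / h ^ 4) (q / h ^ 4) i j k l x"
    for i j k l
  proof -
    have "(\<Sum>a\<in>UNIV. \<Sum>b\<in>UNIV. \<Sum>c\<in>UNIV. \<Sum>d\<in>UNIV.
        ?G $ i $ a * ?G $ j $ b * ?G $ k $ c * ?G $ l $ d
          * riemann (rot_metric f) i j k l x * riemann (rot_metric f) a b c d x)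
      = riemann (rot_metric f) i j k l x * (\<Sum>a\<in>UNIV. ?G $ i $ a * (\<Sum>b\<in>UNIV. ?G $ j $ b *
          (\<Sum>c\<in>UNIV. ?G $ k $ c * (\<Sum>d\<in>UNIV. ?G $ l $ d * riemann (rot_metric f) a b c d x))))"
      unfolding sum_distrib_left by (intro sum.cong refl) (simp only: ac_simps)
    then show ?thesis
      unfolding riemann_eq[OF x] h_def[symmetric] p_def[symmetric] q_def[symmetric]
        raise_index[OF x]
      by (simp add: power2_eq_square power4_eq_xxxx)
  qed
  have "p * (p / h\<^sup>2) = (K_rad (norm x))\<^sup>2" "q * (q / h ^ 4) = (K_tan (norm x))\<^sup>2"
    using h by (simp_all add: p_def q_def power2_eq_square power4_eq_xxxx)
  then show ?thesis
    unfolding riemann_norm_def contraction sum_curvature_form_product[OF x] m_def[symmetric]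
    by simp
qed

section \<open>Mean curvature of the distance spheres\<close>

lemma gradient_norm_eq:
  assumes "x \<noteq> 0"
  shows "gradient (rot_metric f) norm x = sgn x"
proof -
  define h where "h = (f (norm x) / norm x)\<^sup>2"
  have "gradient (rot_metric f) norm x $ k = sgn x $ k" for k
  proof -
    have "gradient (rot_metric f) norm x $ k
      = (\<Sum>l\<in>UNIV. (sgn x $ k * sgn x $ l + 1 / h * tproj x l k + 0 * tproj x l k)
         * (1 * sgn x $ l + 0 * tproj x l k + 0 * tproj x l k))"
      unfolding gradient_def matrix_vector_mult_def
      by (simp add: partial_deriv_eqI[OF has_partial_norm[OF assms]] tproj_sym h_def
          inv_metric_eq[of x f, OF assms f_norm_pos[OF assms]])
    then show ?thesis unfolding contract[OF assms] by simp
  qed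
  then show ?thesis by (simp add: vec_eq_iff)
qed

lemma rot_metric_mult_sgn:
  assumes "x \<noteq> 0"
  shows "rot_metric f x *v sgn x = sgn x"
proof -
  define h where "h = (f (norm x) / norm x)\<^sup>2"
  have "(rot_metric f x *v sgn x) $ k = sgn x $ k" for k
  proof -
    have "(rot_metric f x *v sgn x) $ k
      = (\<Sum>l\<in>UNIV. (sgn x $ k * sgn x $ l + h * tproj x l k + 0 * tproj x l k)
         * (1 * sgn x $ l + 0 * tproj x l k + 0 * tproj x l k))"
      unfolding matrix_vector_mult_def
      by (simp add: tproj_sym h_def rot_metric_eq[OF assms])
    then show ?thesis unfolding contract[OF assms] by simp
  qed
  then show ?thesis by (simp add: vec_eq_iff)
qed

lemma unit_normal_norm_eq:
  assumes "x \<noteq> 0"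
  shows "unit_normal (rot_metric f) norm x = sgn x"
  unfolding unit_normal_def gradient_norm_eq[OF assms] metric_inner_def
    rot_metric_mult_sgn[OF assms]
  using assms by (simp add: norm_sgn flip: norm_eq_sqrt_inner)

text \<open>The unit normal is $u$, so this is the shape operator $(f'/f) P$ of the spheres: the flat part
  $P/r$ and the correction by the Christoffel symbols add up.\<close>

lemma cov_deriv_unit_normal:
  assumes "x \<noteq> 0"
  shows "cov_deriv (rot_metric f) v (unit_normal (rot_metric f) norm) x $ k
    = f' (norm x) / f (norm x) * (\<Sum>i\<in>UNIV. v $ i * tproj x i k)"
proof -
  let ?N = "unit_normal (rot_metric f) norm"
  have p: "partial_deriv i (\<lambda>y. ?N y $ k) x = tproj x i k / norm x" for i
    using partial_deriv_cong[of x "\<lambda>y. ?N y $ k" "\<lambda>y. sgn y $ k" i]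
      partial_deriv_eqI[OF has_partial_sgn[OF assms, of i k]] assms
    by (simp add: unit_normal_norm_eq)
  have c: "(\<Sum>j\<in>UNIV. christoffel (rot_metric f) k i j x * ?N x $ j)
      = alpha (norm x) * tproj x i k" for i
  proof -
    have "(\<Sum>j\<in>UNIV. christoffel (rot_metric f) k i j x * ?N x $ j)
      = (\<Sum>j\<in>UNIV. (alpha (norm x) * tproj x k i * sgn x $ j
            + alpha (norm x) * sgn x $ i * tproj x j k + beta (norm x) * sgn x $ k * tproj x j i)
          * (1 * sgn x $ j + 0 * tproj x j k + 0 * tproj x j k))"
      unfolding unit_normal_norm_eq[OF assms] christoffel_eq[OF assms]
      by (intro sum.cong refl) (simp add: tproj_sym algebra_simps)
    then show ?thesis unfolding contract[OF assms] by (simp add: tproj_sym)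
  qed
  have "cov_deriv (rot_metric f) v ?N x $ k
      = (\<Sum>i\<in>UNIV. v $ i * (tproj x i k / norm x + alpha (norm x) * tproj x i k))"
    by (simp add: cov_deriv_def p c)
  then show ?thesis
    by (simp add: alpha_def sum_distrib_left algebra_simps)
qed

lemma mean_curvature_sphere:
  fixes x :: "real^'n::finite"
  assumes "x \<noteq> 0"
  shows "mean_curvature (rot_metric f) (unit_normal (rot_metric f) norm) x
    = (real CARD('n) - 1) * f' (norm x) / f (norm x)"
proof -
  let ?N = "unit_normal (rot_metric f) norm"
  have "cov_deriv (rot_metric f) (sgn x) ?N x = 0"
    by (simp add: vec_eq_iff cov_deriv_unit_normal[OF assms] sum_tproj_sgn[OF assms]
        mult.commute[of "sgn x $ _"])
  moreover have "cov_deriv (rot_metric f) (axis i 1) ?N x $ i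
      = f' (norm x) / f (norm x) * tproj x i i" for i
    unfolding cov_deriv_unit_normal[OF assms] axis_def by (simp add: sum_delta_mult)
  moreover have "(\<Sum>i\<in>UNIV. f' (norm x) / f (norm x) * tproj x i i)
      = (real CARD('n) - 1) * f' (norm x) / f (norm x)"
    unfolding sum_distrib_left[symmetric] sum_tproj_diag[OF assms] by simp
  ultimately show ?thesis
    by (simp add: mean_curvature_def unit_normal_norm_eq[OF assms] metric_inner_def)
qed

lemma minimal_hypersphere_imp_critical:
  assumes "CARD('n::finite) \<ge> 2" "minimal_hypersphere (rot_metric f :: 'n metric) R"
  shows "R > 0" "f' R = 0"
proof -
  show R: "R > 0" using assms(2) by (simp add: minimal_hypersphere_def)
  obtain x :: "real^'n" where x: "norm x = R"
    using R vector_choose_size[of R] by auto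
  then have "mean_curvature (rot_metric f) (unit_normal (rot_metric f) norm) x = 0"
    using assms(2) by (simp add: minimal_hypersphere_def)
  moreover have "x \<noteq> 0" using x R by auto
  ultimately show "f' R = 0"
    using assms(1) f_pos[OF R] x mean_curvature_sphere[of x] by auto
qed

section \<open>Volume\<close>

text \<open>An orthogonal matrix that takes a coordinate axis to $u$ diagonalizes the metric, with the
  eigenvalue $1$ once and the eigenvalue $h$ otherwise.\<close>

lemma det_rot_metric:
  fixes x :: "real^'n::finite"
  assumes "x \<noteq> 0"
  shows "det (rot_metric f x) = (f (norm x) / norm x) ^ (2 * (CARD('n) - 1))"
proof -
  define h where "h = (f (norm x) / norm x)\<^sup>2"
  (* Any coordinate axis will do. *)
  obtain k :: 'n where True by simp
  have "norm (axis k 1 :: real^'n) = norm (sgn x)"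
    using assms by (simp add: norm_sgn)
  then obtain F where F: "orthogonal_transformation F" "F (axis k 1 :: real^'n) = sgn x"
    by (rule orthogonal_transformation_exists)
  define Q where "Q = matrix F"
  have oQ: "orthogonal_matrix Q"
    using F(1) by (simp add: Q_def orthogonal_transformation_matrix)
  have u: "sgn x $ l = Q $ l $ k" for l
    using F(2) by (simp add: Q_def matrix_def)
  have QQ: "(\<Sum>l\<in>UNIV. Q $ l $ i * Q $ l $ j) = (if i = j then 1 else 0)" for i j
  proof -
    have "(transpose Q ** Q) $ i $ j = mat 1 $ i $ j"
      using oQ by (simp add: orthogonal_matrix_def)
    then show ?thesis by (simp add: matrix_matrix_mult_def transpose_def mat_def)
  qed
  define D :: "real^'n^'n" where
    "D = (\<chi> i j. if i = j then (if i = k then 1 else h) else 0)"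
  have "(rot_metric f x ** Q) $ i $ j = (Q ** D) $ i $ j" for i j
  proof -
    have "(rot_metric f x ** Q) $ i $ j
        = (\<Sum>l\<in>UNIV. h * ((if i = l then 1 else 0) * Q $ l $ j)
            + (1 - h) * Q $ i $ k * (Q $ l $ k * Q $ l $ j))"
      unfolding matrix_matrix_mult_def
      by (simp add: rot_metric_eq[OF assms] tproj_def u flip: h_def)
        (intro sum.cong refl, simp add: algebra_simps)
    also have "\<dots> = h * Q $ i $ j + (1 - h) * Q $ i $ k * (if k = j then 1 else 0)"
      unfolding sum.distrib sum_distrib_left[symmetric] QQ sum_delta_mult ..
    also have "\<dots> = (Q ** D) $ i $ j"
      by (simp add: matrix_matrix_mult_def D_def if_distrib cong: if_cong)
        (simp add: algebra_simps)
    finally show ?thesis .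
  qed
  then have "rot_metric f x ** Q = Q ** D" by (simp add: vec_eq_iff)
  then have "det (rot_metric f x) * det Q = det Q * det D" by (metis det_mul)
  moreover have "det Q \<noteq> 0" using det_orthogonal_matrix[OF oQ] by auto
  ultimately have "det (rot_metric f x) = det D" by simp
  also have "\<dots> = (\<Prod>i\<in>UNIV. D $ i $ i)" by (rule det_diagonal) (simp add: D_def)
  also have "\<dots> = (\<Prod>i\<in>UNIV - {k}. h)"
    by (simp add: D_def prod.If_cases Compl_eq_Diff_UNIV[symmetric] flip: Collect_neg_eq)
  finally show ?thesis by (simp add: h_def power_mult card_Diff_singleton)
qed

end

section \<open>Polar coordinates and estimates in one variable\<close>

text \<open>Polar coordinates for radial functions.  Both measures give the half-line up to $a$ the volume of
  the ball of radius $a$, and a measure that is finite on these half-lines is determined by them.\<close>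

lemma distr_norm_lborel:
  "distr (lborel :: 'a::euclidean_space measure) borel norm
    = density lborel (\<lambda>r. ennreal (unit_ball_vol (DIM('a)) * real DIM('a) * r ^ (DIM('a) - 1))
        * indicator {0..} r)"
  (is "?M = ?N")
proof (rule measure_eqI_generator_eq[where E = "range atMost" and \<Omega> = UNIV and A = "\<lambda>i. {..real i}"])
  let ?w = "unit_ball_vol (DIM('a))" and ?n = "DIM('a)"
  have M: "emeasure ?M {..a} = ennreal (?w * a ^ ?n)" if "a \<ge> 0" for a
  proof -
    have "norm -` {..a} = (cball 0 a :: 'a set)" by auto
    then show ?thesis using that by (simp add: emeasure_distr emeasure_cball)
  qed
  have M0: "emeasure ?M {..a} = 0" if "a < 0" for a
  proof -
    have "norm -` {..a} = ({} :: 'a set)" using that by (auto dest: order_trans[OF norm_ge_zero])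
    then show ?thesis by (simp add: emeasure_distr)
  qed
  show "emeasure ?M X = emeasure ?N X" if E: "X \<in> range atMost" for X
  proof -
    obtain a where X: "X = {..a}" using E by auto
    have N: "emeasure ?N X = (\<integral>\<^sup>+r. ennreal (?w * real ?n * r ^ (?n - 1)) * indicator {0..a} r \<partial>lborel)"
      unfolding X by (subst emeasure_density)
        (auto intro!: nn_integral_cong simp: indicator_def)
    show ?thesis
    proof (cases "a \<ge> 0")
      case True
      have "(\<integral>\<^sup>+r. ennreal (?w * real ?n * r ^ (?n - 1)) * indicator {0..a} r \<partial>lborel)
          = ennreal (?w * a ^ ?n - ?w * 0 ^ ?n)"
        using True by (intro nn_integral_FTC_Icc) (auto intro!: derivative_eq_intros)
      then show ?thesis using N M[OF True] X by (simp add: power_0_left)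
    next
      case False
      then show ?thesis using N M0[of a] X by simp
    qed
  qed
  show "Int_stable (range (atMost :: real \<Rightarrow> real set))"
    by (auto simp: Int_stable_def)
  show "sets ?M = sigma_sets UNIV (range atMost)" "sets ?N = sigma_sets UNIV (range atMost)"
    by (simp_all add: borel_eq_atMost)
  show "(\<Union>i. {..real i}) = UNIV" by (auto intro: real_arch_simple)
  show "emeasure ?M {..real i} \<noteq> \<infinity>" for i by (simp add: M)
qed auto

lemma nn_integral_radial:
  fixes F :: "real \<Rightarrow> ennreal"
  assumes [measurable]: "F \<in> borel_measurable borel"
  shows "(\<integral>\<^sup>+x. F (norm (x::'a::euclidean_space)) \<partial>lborel)
    = (\<integral>\<^sup>+r. ennreal (unit_ball_vol (DIM('a)) * real DIM('a) * r ^ (DIM('a) - 1))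
        * indicator {0..} r * F r \<partial>lborel)"
proof -
  have "(\<integral>\<^sup>+x. F (norm (x::'a)) \<partial>lborel) = (\<integral>\<^sup>+r. F r \<partial>distr (lborel :: 'a measure) borel norm)"
    by (subst nn_integral_distr) auto
  then show ?thesis
    unfolding distr_norm_lborel by (simp add: nn_integral_density)
qed

text \<open>Take for $b$ the first point where $\varphi$ is nonpositive, and then for $a$ the last point before
  $b$ where it is at least $1/2$.\<close>

lemma descent_interval:
  fixes \<phi> :: "real \<Rightarrow> real"
  assumes "R > 0" "continuous_on {0..R} \<phi>" "\<phi> 0 = 1" "\<phi> R = 0"
  obtains a b where "0 \<le> a" "a < b" "\<phi> a \<ge> 1/2" "\<phi> b \<le> 0"
    "\<And>r. r \<in> {a<..<b} \<Longrightarrow> 0 < \<phi> r \<and> \<phi> r < 1/2"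
proof -
  have compact: "compact ({0..c} \<inter> \<phi> -` T)" if "c \<le> R" "closed T" for c T
    using continuous_closed_preimage[OF continuous_on_subset[OF assms(2)], of "{0..c}" T] that
    by (auto simp: compact_eq_bounded_closed intro: bounded_subset[of "{0..c}"])
  have "R \<in> {0..R} \<inter> \<phi> -` {..0}" using assms(1,4) by simp
  then have "\<exists>b\<in>{0..R} \<inter> \<phi> -` {..0}. \<forall>r\<in>{0..R} \<inter> \<phi> -` {..0}. b \<le> r"
    by (intro compact_attains_inf compact) auto
  then obtain b where b: "0 \<le> b" "b \<le> R" "\<phi> b \<le> 0"
    and b_first: "\<And>r. 0 \<le> r \<Longrightarrow> r \<le> R \<Longrightarrow> \<phi> r \<le> 0 \<Longrightarrow> b \<le> r"
    by auto
  have "0 \<in> {0..b} \<inter> \<phi> -` {1/2..}" using b assms(3) by simp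
  then have "\<exists>a\<in>{0..b} \<inter> \<phi> -` {1/2..}. \<forall>r\<in>{0..b} \<inter> \<phi> -` {1/2..}. r \<le> a"
    using b by (intro compact_attains_sup compact) auto
  then obtain a where a: "0 \<le> a" "a \<le> b" "\<phi> a \<ge> 1/2"
    and a_last: "\<And>r. 0 \<le> r \<Longrightarrow> r \<le> b \<Longrightarrow> \<phi> r \<ge> 1/2 \<Longrightarrow> r \<le> a"
    by auto
  show thesis
  proof (rule that)
    show "a < b" using a b by (cases "a = b") auto
    show "0 < \<phi> r \<and> \<phi> r < 1/2" if "r \<in> {a<..<b}" for r
      using that a b a_last[of r] b_first[of r] by (auto simp: not_le[symmetric])
  qed (use a b in auto)
qed

lemma total_variation_le_nn_integral:
  fixes g g' :: "real \<Rightarrow> real"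
  assumes "a \<le> b" "\<And>r. (g has_real_derivative g' r) (at r)" "continuous_on UNIV g'"
  shows "ennreal (g a - g b) \<le> (\<integral>\<^sup>+r. ennreal \<bar>g' r\<bar> * indicator {a<..<b} r \<partial>lborel)"
proof -
  have "(g' has_integral (g b - g a)) {a..b}"
    using assms(1,2)
    by (intro fundamental_theorem_of_calculus)
      (auto simp: has_real_derivative_iff_has_vector_derivative[symmetric] has_field_derivative_at_within)
  then have i: "((\<lambda>r. - g' r) has_integral (g a - g b)) {a..b}"
    using has_integral_neg[of g' "g b - g a" "{a..b}"] by simp
  have "(\<lambda>r. \<bar>g' r\<bar>) integrable_on {a..b}"
    using continuous_on_subset[OF assms(3)] by (intro integrable_continuous_real continuous_intros) auto
  then obtain I where I: "((\<lambda>r. \<bar>g' r\<bar>) has_integral I) {a..b}" by blast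
  have "g a - g b \<le> I" by (rule has_integral_le[OF i I]) auto
  moreover have "((\<lambda>r. \<bar>g' r\<bar>) has_integral I) {a<..<b}"
    using I has_integral_open_interval[of "\<lambda>r. \<bar>g' r\<bar>" I a b] by (simp add: box_real)
  from nn_integral_has_integral_lebesgue'[OF _ this]
  have "(\<integral>\<^sup>+r. ennreal \<bar>g' r\<bar> * indicator {a<..<b} r \<partial>lborel) = ennreal I" by simp
  ultimately show ?thesis by (simp add: ennreal_leI)
qed

text \<open>Here \<open>y\<close>, \<open>s\<close> and \<open>z\<close> stand for the values of $f$, $f'$ and $f''$ at one radius.\<close>

lemma curvature_density_bound:
  fixes y z s :: real
  fixes n :: nat
  assumes "n \<ge> 2" "y > 0" "\<bar>s\<bar> \<le> 1/2"
  shows "\<bar>z\<bar> \<le> sqrt (4 * (real n - 1) * (- z / y)\<^sup>2 + 2 * (real n - 1) * (real n - 2) * ((1 - s\<^sup>2) / y\<^sup>2)\<^sup>2)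
      powr (real n / 2) * y ^ (n - 1)"
    (is "_ \<le> ?\<rho> powr _ * _")
proof -
  have "\<bar>z / y\<bar> = sqrt ((- z / y)\<^sup>2)" by simp
  also have "\<dots> \<le> ?\<rho>"
  proof (rule real_sqrt_le_mono)
    have "1 * (- z / y)\<^sup>2 \<le> 4 * (real n - 1) * (- z / y)\<^sup>2"
      using assms(1) by (intro mult_right_mono) auto
    moreover have "0 \<le> 2 * (real n - 1) * (real n - 2) * ((1 - s\<^sup>2) / y\<^sup>2)\<^sup>2"
      using assms(1) by auto
    ultimately show "(- z / y)\<^sup>2 \<le> 4 * (real n - 1) * (- z / y)\<^sup>2
        + 2 * (real n - 1) * (real n - 2) * ((1 - s\<^sup>2) / y\<^sup>2)\<^sup>2" by linarith
  qed
  finally have rad: "\<bar>z\<bar> \<le> ?\<rho> * y"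
    using assms(2) by (simp add: field_simps)
  show ?thesis
  proof (cases "n = 2")
    case True
    then show ?thesis using rad by simp
  next
    case False
    then have n: "real n \<ge> 3" using assms(1) by linarith
    have "s\<^sup>2 \<le> (1/2)\<^sup>2" using assms(3) by (metis abs_le_square_iff abs_of_nonneg zero_le_divide_1_iff zero_le_numeral)
    then have s: "3/4 \<le> 1 - s\<^sup>2" by (simp add: power2_eq_square)
    (* 4 is the value of the coefficient 2 (n - 1) (n - 2) at n = 3, and sqrt 4 * 3/4 is at least 1. *)
    have "(1 / y\<^sup>2)\<^sup>2 \<le> 4 * ((3/4) / y\<^sup>2)\<^sup>2"
      using assms(2) by (simp add: power_divide field_simps)
    also have "\<dots> \<le> 4 * ((1 - s\<^sup>2) / y\<^sup>2)\<^sup>2"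
      using s assms(2) by (intro mult_left_mono power_mono divide_right_mono) auto
    also have "\<dots> \<le> 2 * (real n - 1) * (real n - 2) * ((1 - s\<^sup>2) / y\<^sup>2)\<^sup>2"
    proof (rule mult_right_mono)
      have "2 * 1 \<le> (real n - 1) * (real n - 2)" using n by (intro mult_mono) auto
      then show "4 \<le> 2 * (real n - 1) * (real n - 2)" by linarith
    qed simp
    also have "\<dots> \<le> 4 * (real n - 1) * (- z / y)\<^sup>2
        + 2 * (real n - 1) * (real n - 2) * ((1 - s\<^sup>2) / y\<^sup>2)\<^sup>2" using n by simp
    finally have "1 / y\<^sup>2 \<le> ?\<rho>" by (rule real_le_rsqrt)
    then have one: "1 \<le> ?\<rho> * y\<^sup>2" using assms(2) by (simp add: field_simps)
    have "\<bar>z\<bar> \<le> (?\<rho> * y\<^sup>2) / y"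
      using rad assms(2) by (simp add: power2_eq_square)
    also have "\<dots> \<le> (?\<rho> * y\<^sup>2) powr (real n / 2) / y"
    proof (rule divide_right_mono)
      have "(?\<rho> * y\<^sup>2) powr 1 \<le> (?\<rho> * y\<^sup>2) powr (real n / 2)"
        using n one by (intro powr_mono) auto
      then show "?\<rho> * y\<^sup>2 \<le> (?\<rho> * y\<^sup>2) powr (real n / 2)"
        using one by (subst (asm) powr_one) auto
    qed (use assms(2) in simp)
    also have "(?\<rho> * y\<^sup>2) powr (real n / 2) = ?\<rho> powr (real n / 2) * y ^ n"
    proof -
      have "(y\<^sup>2) powr (real n / 2) = y powr (real n)"
        using powr_powr[of y 2 "real n / 2"] assms(2) by simp
      then show ?thesis using assms(2) n by (simp add: powr_mult powr_realpow)
    qed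
    also have "?\<rho> powr (real n / 2) * y ^ n / y = ?\<rho> powr (real n / 2) * y ^ (n - 1)"
      using assms(1,2) by (simp add: power_diff)
    finally show ?thesis .
  qed
qed

section \<open>The lower bound for the curvature integral\<close>

context warping
begin

text \<open>The powers of $r$ from the volume density and from polar coordinates combine to $f^{n-1}$, so the
  integrand in $r$ dominates $|f''|$ on the interval, and $|f''|$ integrates to at least the drop of
  $f'$.\<close>

lemma curvature_integral_ge:
  assumes "continuous_on UNIV f''" "0 \<le> a" "a \<le> b"
    and "\<And>r. r \<in> {a<..<b} \<Longrightarrow> \<bar>f' r\<bar> \<le> 1/2"
    and n: "CARD('n::finite) \<ge> 2"
  shows "ennreal (unit_ball_vol (real CARD('n)) * real CARD('n) * (f' a - f' b))
    \<le> curvature_integral (rot_metric f :: 'n metric)"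
proof -
  define m where "m = real CARD('n)"
  define \<omega> where "\<omega> = unit_ball_vol m * m"
  have \<omega>: "\<omega> \<ge> 0" by (simp add: \<omega>_def m_def)
  define F where "F r = sqrt (4 * (m - 1) * (K_rad r)\<^sup>2 + 2 * (m - 1) * (m - 2) * (K_tan r)\<^sup>2)
    powr (m / 2)" for r
  define V where "V r = (f r / r) ^ (CARD('n) - 1)" for r
  let ?g = "rot_metric f :: 'n metric"
  have cont: "continuous_on UNIV f" "continuous_on UNIV f'"
    using f_deriv f'_deriv DERIV_isCont by (blast intro: continuous_at_imp_continuous_on)+
  have [measurable]: "f \<in> borel_measurable borel" "f' \<in> borel_measurable borel"
      "f'' \<in> borel_measurable borel"
    using cont assms(1) by (auto intro: borel_measurable_continuous_onI)
  have [measurable]: "F \<in> borel_measurable borel" "V \<in> borel_measurable borel"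
    unfolding F_def[abs_def] V_def[abs_def] K_rad_def K_tan_def by measurable
  (* The values at the origin, a null set, appear only because the closed forms do not cover it. *)
  define N\<^sub>0 D\<^sub>0 where "N\<^sub>0 = riemann_norm ?g 0 powr (real CARD('n) / 2)" and "D\<^sub>0 = sqrt (det (?g 0))"
  have integrand: "riemann_norm ?g x powr (real CARD('n) / 2) = (if x = 0 then N\<^sub>0 else F (norm x))" for x
    by (simp add: riemann_norm_eq F_def m_def N\<^sub>0_def)
  have volume: "sqrt (det (?g x)) = (if x = 0 then D\<^sub>0 else V (norm x))" for x
    using f_norm_pos[of x] by (cases "x = 0") (simp_all add: det_rot_metric V_def D\<^sub>0_def power_mult real_sqrt_power)
  have "curvature_integral ?g
     = (\<integral>\<^sup>+x. ennreal (if x = 0 then D\<^sub>0 else V (norm x))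
          * ennreal (if x = 0 then N\<^sub>0 else F (norm x)) \<partial>(lborel :: (real^'n) measure))"
    unfolding curvature_integral_def riem_volume_def integrand volume
    by (rule nn_integral_density) measurable
  also have "\<dots> = (\<integral>\<^sup>+x. ennreal (V (norm x)) * ennreal (F (norm x)) \<partial>(lborel :: (real^'n) measure))"
    by (rule nn_integral_cong_AE, rule eventually_mono[OF AE_lborel_singleton[of 0]]) simp
  also have "\<dots> = (\<integral>\<^sup>+r. ennreal (\<omega> * r ^ (CARD('n) - 1)) * indicator {0..} r
      * (ennreal (V r) * ennreal (F r)) \<partial>lborel)"
    by (subst nn_integral_radial[where F = "\<lambda>r. ennreal (V r) * ennreal (F r)"])
      (simp_all add: \<omega>_def m_def)
  finally have polar: "curvature_integral ?g
    = (\<integral>\<^sup>+r. ennreal (\<omega> * r ^ (CARD('n) - 1)) * indicator {0..} r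
      * (ennreal (V r) * ennreal (F r)) \<partial>lborel)" .
  have "ennreal (\<omega> * (f' a - f' b)) = ennreal \<omega> * ennreal (f' a - f' b)"
    using \<omega> by (rule ennreal_mult')
  also have "\<dots> \<le> ennreal \<omega> * (\<integral>\<^sup>+r. ennreal \<bar>f'' r\<bar> * indicator {a<..<b} r \<partial>lborel)"
    by (intro mult_left_mono total_variation_le_nn_integral assms f'_deriv) auto
  also have "\<dots> = (\<integral>\<^sup>+r. ennreal \<omega> * (ennreal \<bar>f'' r\<bar> * indicator {a<..<b} r) \<partial>lborel)"
    by (rule nn_integral_cmult[symmetric]) measurable
  also have "\<dots> \<le> curvature_integral ?g"
    unfolding polar
  proof (rule nn_integral_mono)
    fix r
    show "ennreal \<omega> * (ennreal \<bar>f'' r\<bar> * indicator {a<..<b} r)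
      \<le> ennreal (\<omega> * r ^ (CARD('n) - 1)) * indicator {0..} r * (ennreal (V r) * ennreal (F r))"
    proof (cases "r \<in> {a<..<b}")
      case True
      then have r: "r > 0" using assms(2) by auto
      have "\<bar>f'' r\<bar> \<le> F r * f r ^ (CARD('n) - 1)"
        using curvature_density_bound[OF n f_pos[OF r] assms(4)[OF True], of "f'' r"]
        by (simp add: F_def m_def K_rad_def K_tan_def)
      also have "\<dots> = r ^ (CARD('n) - 1) * (V r * F r)"
        using r by (simp add: V_def power_divide)
      finally have "\<omega> * \<bar>f'' r\<bar> \<le> \<omega> * r ^ (CARD('n) - 1) * (V r * F r)"
        using \<omega> by (simp add: mult.assoc mult_left_mono)
      moreover have "V r \<ge> 0" "F r \<ge> 0"
        using r f_pos[OF r] by (simp_all add: V_def F_def)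
      ultimately show ?thesis
        using True r \<omega> by (simp add: ennreal_mult[symmetric])
    qed simp
  qed
  finally show ?thesis by (simp add: \<omega>_def m_def)
qed

end

theorem theorem5:
  assumes "CARD('n::finite) \<ge> 2"
  shows "\<exists>C>0::real. \<forall>g :: 'n metric.
           rotationally_symmetric g \<longrightarrow> curvature_integral g < ennreal C \<longrightarrow>
           \<not> (\<exists>R. minimal_hypersphere g R)"
proof (intro exI[of _ "unit_ball_vol (real CARD('n)) * real CARD('n) * (1/2)"] conjI allI impI notI)
  let ?\<omega> = "unit_ball_vol (real CARD('n)) * real CARD('n)"
  show "0 < ?\<omega> * (1/2)" by simp
  fix g :: "'n metric"
  assume "rotationally_symmetric g" and small: "curvature_integral g < ennreal (?\<omega> * (1/2))"
    and "\<exists>R. minimal_hypersphere g R"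
  then obtain f R where f: "warping_function f" and g: "g = rot_metric f"
    and R: "minimal_hypersphere (rot_metric f :: 'n metric) R"
    by (auto simp: rotationally_symmetric_def)
  have smooth: "(deriv ^^ k) f differentiable (at r)" for k r
    using f by (simp add: warping_function_def smooth_real_def)
  have d: "((deriv ^^ k) f has_real_derivative (deriv ^^ Suc k) f r) (at r)" for k r
    using smooth[of k r] by (simp add: DERIV_deriv_iff_real_differentiable)
  interpret warping f "deriv f" "deriv (deriv f)"
    using d[of 0] d[of 1] f by unfold_locales (simp_all add: warping_function_def)
  note crit = minimal_hypersphere_imp_critical[OF assms R]
  have cont: "continuous_on S ((deriv ^^ k) f)" for k S
    using d[of k] DERIV_isCont by (blast intro: continuous_at_imp_continuous_on)
  have "deriv f 0 = 1" using f by (simp add: warping_function_def)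
  then obtain a b where ab: "0 \<le> a" "a < b" "deriv f a \<ge> 1/2" "deriv f b \<le> 0"
    "\<And>r. r \<in> {a<..<b} \<Longrightarrow> 0 < deriv f r \<and> deriv f r < 1/2"
    using descent_interval[of R "deriv f"] crit cont[of _ 1] by auto
  have "ennreal (?\<omega> * (1/2)) \<le> ennreal (?\<omega> * (deriv f a - deriv f b))"
    using ab by (intro ennreal_leI mult_left_mono) auto
  also have "\<dots> \<le> curvature_integral g"
    unfolding g using ab assms cont[of UNIV 2]
    by (intro curvature_integral_ge) (auto simp: numeral_2_eq_2 less_imp_le abs_le_iff)
  finally show False using small by simp
qed

end
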